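(* Under the $L^2$ Wasserstein loss, any predictive density $\hat{p}(y\mid x^n)$ with mean $\hat{\mu}(x^n)$ and covariance $\hat{\Sigma}(x^n)$ is dominated by the plug-in density $p(y\mid\hat{\mu}(x^n),\hat{\sigma}(x^n))$, where $\hat{\sigma}(x^n)=d^{-1}\,\mathrm{tr}(\hat{\Sigma}(x^n)^{1/2})$. That is, writing $\hat{p}_{\mathrm{plug}}(y\mid x^n)=p(y\mid\hat{\mu}(x^n),\hat{\sigma}(x^n))$, one has $R((\mu,\sigma),\hat{p}_{\mathrm{plug}})\le R((\mu,\sigma),\hat{p})$ for every $(\mu,\sigma)$, and $R((\mu,\sigma),\hat{p}_{\mathrm{plug}})<R((\mu,\sigma),\hat{p})$ for some $(\mu,\sigma)$.
   Context: Let $f:\mathbb{R}^d\to[0,\infty)$ satisfy $\int f(z)\,\mathrm{d}z=1$, $\int z f(z)\,\mathrm{d}z=0$ and $\int zz^\top f(z)\,\mathrm{d}z=I_d$, and let $p(z\mid\mu,\sigma)=\sigma^{-d}f((z-\mu)/\sigma)$, $\mu\in\mathbb{R}^d$, $\sigma>0$, be the associated location-scale family. Independent observations $x^n=(x_1,\ldots,x_n)$, $x_i\sim p(x\mid\mu,\sigma)$, are used to predict $y\sim p(y\mid\mu,\sigma)$, with $(\mu,\sigma)$ unknown; write $p(x^n\mid\mu,\sigma)=\prod_i p(x_i\mid\mu,\sigma)$. A predictive density $\hat{p}(y\mid x^n)$ is, for each $x^n$, a probability density in $y\in\mathbb{R}^d$. Attention is restricted to predictive densities with finite mean and covariance, since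 the loss would diverge otherwise. For probability distributions $p_1,p_2$ on $\mathbb{R}^d$, $W_2(p_1,p_2)=\inf_{X,Y}\mathrm{E}[\|X-Y\|^2]^{1/2}$, the infimum being over all joint distributions of $(X,Y)$ with marginals $p_1$ and $p_2$. The $L^2$ Wasserstein loss is $W_2(p(y\mid\mu,\sigma),\hat{p}(y\mid x^n))^2$, and the risk is $R((\mu,\sigma),\hat{p})=\int W_2(p(y\mid\mu,\sigma),\hat{p}(y\mid x^n))^2\,p(x^n\mid\mu,\sigma)\,\mathrm{d}x^n$. A predictive density $\hat{p}_1$ is said to dominate $\hat{p}_2$ if $R((\mu,\sigma),\hat{p}_1)\le R((\mu,\sigma),\hat{p}_2)$ for every $(\mu,\sigma)$ and $R((\mu,\sigma),\hat{p}_1)<R((\mu,\sigma),\hat{p}_2)$ for some $(\mu,\sigma)$.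
   Formalization: The strict inequality is claimed only if, for some (μ,σ), the plug-in risk is finite and p̂ differs from p̂_plug with positive probability; without this it fails, e.g. when p̂ is itself a plug-in density. *)

theory Defs
  imports "HOL-Analysis.Analysis"
begin

definition outer_product :: "real^'d \<Rightarrow> real^'d \<Rightarrow> real^'d^'d" where
  "outer_product u v = (\<chi> i j. u $ i * v $ j)"

text \<open>Requiring \<open>has_bochner_integral\<close> makes existence (absolute convergence) of the
  integrals part of the definitions.\<close>

definition prob_density :: "(real^'d \<Rightarrow> real) \<Rightarrow> bool" where
  "prob_density p \<longleftrightarrow> (\<forall>y. 0 \<le> p y) \<and> has_bochner_integral lborel p 1"

definition has_mean :: "(real^'d \<Rightarrow> real) \<Rightarrow> real^'d \<Rightarrow> bool" where
  "has_mean p m \<longleftrightarrow> has_bochner_integral lborel (\<lambda>y. p y *\<^sub>R y) m"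

definition has_mean_covariance :: "(real^'d \<Rightarrow> real) \<Rightarrow> real^'d \<Rightarrow> real^'d^'d \<Rightarrow> bool" where
  "has_mean_covariance p m S \<longleftrightarrow> has_mean p m \<and>
     has_bochner_integral lborel (\<lambda>y. p y *\<^sub>R outer_product (y - m) (y - m)) S"

definition standardized_density :: "(real^'d \<Rightarrow> real) \<Rightarrow> bool" where
  "standardized_density f \<longleftrightarrow> prob_density f \<and>
     has_bochner_integral lborel (\<lambda>z. f z *\<^sub>R z) 0 \<and>
     has_bochner_integral lborel (\<lambda>z. f z *\<^sub>R outer_product z z) (mat 1)"

definition loc_scale :: "(real^'d \<Rightarrow> real) \<Rightarrow> real^'d \<Rightarrow> real \<Rightarrow> real^'d \<Rightarrow> real" where
  "loc_scale f \<mu> \<sigma> z = f ((z - \<mu>) /\<^sub>R \<sigma>) / \<sigma> ^ CARD('d)"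

text \<open>A sample of \<open>n = CARD('n)\<close> observations is a vector in \<open>real^'d^'n\<close>, whose \<open>lborel\<close> is
  Lebesgue measure on the \<open>dn\<close>-dimensional sample space.\<close>

definition sample_density ::
  "(real^'d \<Rightarrow> real) \<Rightarrow> real^'d \<Rightarrow> real \<Rightarrow> real^'d^'n \<Rightarrow> real" where
  "sample_density f \<mu> \<sigma> xs = (\<Prod>i\<in>UNIV. loc_scale f \<mu> \<sigma> (xs $ i))"

definition predictive_density :: "(real^'d^'n \<Rightarrow> real^'d \<Rightarrow> real) \<Rightarrow> bool" where
  "predictive_density phat \<longleftrightarrow>
     (\<lambda>(xs, y). phat xs y) \<in> borel_measurable borel \<and> (\<forall>xs. prob_density (phat xs))"

definition pos_semidef :: "real^'d^'d \<Rightarrow> bool" where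
  "pos_semidef A \<longleftrightarrow> transpose A = A \<and> (\<forall>v. 0 \<le> v \<bullet> (A *v v))"

text \<open>Meaningful for positive semidefinite matrices, which have exactly one
  positive semidefinite square root.\<close>

definition mat_sqrt :: "real^'d^'d \<Rightarrow> real^'d^'d" where
  "mat_sqrt A = (THE S. pos_semidef S \<and> S ** S = A)"

definition plug_in ::
  "(real^'d \<Rightarrow> real) \<Rightarrow> (real^'d^'n \<Rightarrow> real^'d) \<Rightarrow> (real^'d^'n \<Rightarrow> real^'d^'d) \<Rightarrow>
   real^'d^'n \<Rightarrow> real^'d \<Rightarrow> real" where
  "plug_in f muhat Sigmahat xs =
     loc_scale f (muhat xs) (trace (mat_sqrt (Sigmahat xs)) / real CARD('d))"

definition couplings ::
  "(real^'d) measure \<Rightarrow> (real^'d) measure \<Rightarrow> ((real^'d) \<times> (real^'d)) measure set" where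
  "couplings P Q = {\<gamma>. sets \<gamma> = sets borel \<and> distr \<gamma> borel fst = P \<and> distr \<gamma> borel snd = Q}"

text \<open>The square root on \<open>[0,\<infinity>]\<close>; the case split is needed because \<open>enn2real \<infinity> = 0\<close>.\<close>

definition ennsqrt :: "ennreal \<Rightarrow> ennreal" where
  "ennsqrt c = (if c = \<infinity> then \<infinity> else ennreal (sqrt (enn2real c)))"

definition W2 :: "(real^'d) measure \<Rightarrow> (real^'d) measure \<Rightarrow> ennreal" where
  "W2 P Q = (INF \<gamma>\<in>couplings P Q. ennsqrt (\<integral>\<^sup>+ (x, y). ennreal ((norm (x - y))\<^sup>2) \<partial>\<gamma>))"

definition W2_loss :: "(real^'d \<Rightarrow> real) \<Rightarrow> (real^'d \<Rightarrow> real) \<Rightarrow> ennreal" where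
  "W2_loss p q = (W2 (density lborel (\<lambda>y. ennreal (p y))) (density lborel (\<lambda>y. ennreal (q y))))\<^sup>2"

text \<open>The risk takes values in \<open>[0,\<infinity>]\<close>: it may diverge although every predictive density
  has finite second moments.\<close>

definition risk ::
  "(real^'d \<Rightarrow> real) \<Rightarrow> real^'d \<Rightarrow> real \<Rightarrow> (real^'d^'n \<Rightarrow> real^'d \<Rightarrow> real) \<Rightarrow> ennreal" where
  "risk f \<mu> \<sigma> phat =
     (\<integral>\<^sup>+ xs. W2_loss (loc_scale f \<mu> \<sigma>) (phat xs) * ennreal (sample_density f \<mu> \<sigma> xs) \<partial>lborel)"

definition dominates ::
  "(real^'d \<Rightarrow> real) \<Rightarrow> (real^'d^'n \<Rightarrow> real^'d \<Rightarrow> real) \<Rightarrow> (real^'d^'n \<Rightarrow> real^'d \<Rightarrow> real) \<Rightarrow> bool" where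
  "dominates f p1 p2 \<longleftrightarrow>
     (\<forall>\<mu> \<sigma>. 0 < \<sigma> \<longrightarrow> risk f \<mu> \<sigma> p1 \<le> risk f \<mu> \<sigma> p2) \<and>
     (\<exists>\<mu> \<sigma>. 0 < \<sigma> \<and> risk f \<mu> \<sigma> p1 < risk f \<mu> \<sigma> p2)"

text \<open>The predictive densities \<open>p1\<close> and \<open>p2\<close> describe the same distribution for almost every
  sample drawn with parameter \<open>(\<mu>, \<sigma>)\<close>.\<close>

definition same_predictive ::
  "(real^'d \<Rightarrow> real) \<Rightarrow> real^'d \<Rightarrow> real \<Rightarrow>
   (real^'d^'n \<Rightarrow> real^'d \<Rightarrow> real) \<Rightarrow> (real^'d^'n \<Rightarrow> real^'d \<Rightarrow> real) \<Rightarrow> bool" where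
  "same_predictive f \<mu> \<sigma> p1 p2 \<longleftrightarrow>
     (AE xs in density lborel (\<lambda>xs. ennreal (sample_density f \<mu> \<sigma> xs)).
        AE y in lborel. p1 xs y = p2 xs y)"

end

theory Submission
  imports Defs
begin

text \<open>Let \<open>m\<close>, \<open>S\<close> be the mean and covariance of a predictive density and \<open>s = tr S\<^sup>1\<^sup>/\<^sup>2 / d\<close>. Gelbrich's
  bound gives a squared Wasserstein distance of at least
  \<open>|\<mu> - m|\<^sup>2 + d \<sigma>\<^sup>2 + tr S - 2 \<sigma> d s\<close> from the true density, and \<open>tr S \<ge> d s\<^sup>2\<close>, so the loss is at least
  \<open>|\<mu> - m|\<^sup>2 + d (\<sigma> - s)\<^sup>2\<close>, which the plug-in density attains by coupling \<open>\<mu> + \<sigma> Z\<close> with \<open>m + s Z\<close>.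

  For the strict inequality the bound is quantified: the excess loss is at least \<open>min(1, \<sigma>/s)\<close> times
  the squared distance of the predictive density from its plug-in density. Testing the
  two densities against a countable separating family of Lipschitz functions bounds this below by a
  measurable function of the sample, so that the measurability of the loss itself is never needed.\<close>

section \<open>Spectral theorem for real symmetric matrices\<close>

lemma symmetric_inner_matrix_vector:
  fixes A :: "real^'d^'d"
  assumes "transpose A = A"
  shows "x \<bullet> (A *v y) = (A *v x) \<bullet> y"
  by (metis assms dot_lmul_matrix vector_transpose_matrix)

text \<open>Let \<open>u\<close> maximize \<open>x \<bullet> (A *v x)\<close> over the compact unit
  sphere of \<open>V\<close>, with maximum \<open>l\<close>. The form \<open>Q\<close> = l |x|^2 -
  x.Ax is nonnegative on \<open>V\<close> and vanishes at \<open>u\<close>, so its first variation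
  at \<open>u\<close> is zero. In the direction w = l u - A u, which lies in \<open>V\<close> by
  invariance, that variation is 2 |w|^2.\<close>

lemma symmetric_eigenvector_exists:
  fixes A :: "real^'d^'d"
  assumes sym: "transpose A = A" and V: "subspace V"
    and inv: "\<And>x. x \<in> V \<Longrightarrow> A *v x \<in> V" and ne: "V \<noteq> {0}"
  obtains u l where "u \<in> V" "norm u = 1" "A *v u = l *\<^sub>R u"
proof -
  let ?K = "V \<inter> sphere 0 1"
  obtain x0 where x0: "x0 \<in> V" "x0 \<noteq> 0"
    using ne subspace_0[OF V] by blast
  then have "x0 /\<^sub>R norm x0 \<in> ?K"
    using V by (simp add: subspace_scale)
  then have "?K \<noteq> {}" by blast
  moreover have "compact ?K"
    using V by (simp add: closed_Int_compact closed_subspace)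
  moreover have "continuous_on ?K (\<lambda>x. x \<bullet> (A *v x))"
    by (intro continuous_intros matrix_vector_mult_linear_continuous_on)
  ultimately obtain u where u: "u \<in> ?K" and max: "\<And>x. x \<in> ?K \<Longrightarrow> x \<bullet> (A *v x) \<le> u \<bullet> (A *v u)"
    using continuous_attains_sup by meson
  define l where "l = u \<bullet> (A *v u)"
  have uV: "u \<in> V" and nu: "norm u = 1" using u by auto
  then have uu: "u \<bullet> u = 1" by (simp add: dot_square_norm)
  define Q where "Q x = l * (x \<bullet> x) - x \<bullet> (A *v x)" for x
  have Q_nonneg: "0 \<le> Q x" if "x \<in> V" for x
  proof (cases "x = 0")
    case False
    with that V have "x /\<^sub>R norm x \<in> ?K" by (simp add: subspace_scale)
    from max[OF this] have "(x \<bullet> (A *v x)) / (norm x)\<^sup>2 \<le> l"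
      by (simp add: l_def matrix_vector_mult_scaleR power2_eq_square divide_inverse mult_ac)
    with False have "x \<bullet> (A *v x) \<le> l * (norm x)\<^sup>2"
      by (simp add: divide_le_eq)
    then show ?thesis by (simp add: Q_def dot_square_norm)
  qed (simp add: Q_def)
  define w where "w = l *\<^sub>R u - A *v u"
  have wV: "w \<in> V"
    unfolding w_def using V uV inv by (simp add: subspace_diff subspace_scale)
  have expand: "Q (u + t *\<^sub>R w) = 2 * t * (w \<bullet> w) + t\<^sup>2 * Q w" for t
  proof -
    have wu: "(A *v u) \<bullet> w = l * (u \<bullet> w) - w \<bullet> w"
      by (simp add: w_def inner_diff_left)
    have "u \<bullet> (A *v w) = (A *v u) \<bullet> w" "w \<bullet> (A *v u) = (A *v u) \<bullet> w"
      by (rule symmetric_inner_matrix_vector[OF sym]) (rule inner_commute)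
    moreover have "Q (u + t *\<^sub>R w) = l * (u \<bullet> u + 2 * t * (u \<bullet> w) + t\<^sup>2 * (w \<bullet> w))
        - (l + t * (u \<bullet> (A *v w)) + t * (w \<bullet> (A *v u)) + t\<^sup>2 * (w \<bullet> (A *v w)))"
      by (simp add: Q_def l_def matrix_vector_mult_scaleR matrix_vector_right_distrib
        inner_add_left inner_add_right power2_eq_square inner_commute[of w u] algebra_simps)
    ultimately have "Q (u + t *\<^sub>R w) = l * (1 + 2 * t * (u \<bullet> w) + t\<^sup>2 * (w \<bullet> w))
        - (l + 2 * t * ((A *v u) \<bullet> w) + t\<^sup>2 * (w \<bullet> (A *v w)))"
      using uu by simp
    then show ?thesis
      unfolding wu Q_def[of w] by (simp add: algebra_simps)
  qed
  have "w \<bullet> w = 0"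
  proof (rule ccontr)
    assume "w \<bullet> w \<noteq> 0"
    then have wp: "0 < w \<bullet> w" by (simp add: order_less_le)
    \<comment> \<open>The parabola 2 t |w|^2 + t^2 q is minimal at t = -|w|^2 / q, where it is
      negative. Adding 1 to \<open>Q w\<close> keeps the divisor positive.\<close>
    define q where "q = Q w + 1"
    have q: "q > 0" "Q w < q" using Q_nonneg[OF wV] by (auto simp: q_def)
    define t where "t = - (w \<bullet> w) / q"
    have "0 \<le> 2 * t * (w \<bullet> w) + t\<^sup>2 * Q w"
      using Q_nonneg[of "u + t *\<^sub>R w"] uV wV V
      by (simp add: expand subspace_add subspace_scale)
    also have "\<dots> \<le> 2 * t * (w \<bullet> w) + t\<^sup>2 * q"
      using q by (intro add_left_mono mult_left_mono) auto
    also have "\<dots> = - ((w \<bullet> w)\<^sup>2 / q)"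
      using q by (simp add: t_def field_simps power2_eq_square)
    also have "\<dots> < 0" using wp q by simp
    finally show False by simp
  qed
  then have "A *v u = l *\<^sub>R u" by (simp add: w_def)
  with uV nu that show ?thesis by blast
qed

text \<open>Induction on the dimension: split off a unit eigenvector \<open>u\<close> and pass to
  its orthogonal complement in \<open>V\<close>, which \<open>A\<close> maps to itself because u.Ax
  = Au.x = k u.x = 0.\<close>

lemma symmetric_eigenbasis_subspace:
  fixes A :: "real^'d^'d"
  assumes sym: "transpose A = A" and "subspace V"
    and "\<And>x. x \<in> V \<Longrightarrow> A *v x \<in> V"
  shows "\<exists>B l. finite B \<and> B \<subseteq> V \<and> pairwise orthogonal B \<and> (\<forall>b\<in>B. norm b = 1 \<and> A *v b = l b *\<^sub>R b)
    \<and> V \<subseteq> span B"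
  using assms(2-3)
proof (induction "dim V" arbitrary: V rule: less_induct)
  case less
  show ?case
  proof (cases "V = {0}")
    case True
    then show ?thesis by (intro exI[of _ "{}"]) auto
  next
    case False
    obtain u k where u: "u \<in> V" "norm u = 1" "A *v u = k *\<^sub>R u"
      using symmetric_eigenvector_exists[OF sym less.prems False] by blast
    define V' where "V' = {x \<in> V. u \<bullet> x = 0}"
    have uu: "u \<bullet> u = 1" using u by (simp add: dot_square_norm)
    have V': "subspace V'"
      using less.prems(1) by (auto simp: V'_def subspace_def inner_add_right)
    have "u \<notin> V'" "V' \<subseteq> V" using uu by (auto simp: V'_def)
    then have "V' \<subset> V" using u(1) by blast
    then have "dim V' < dim V"
      using V' less.prems(1) by (metis dim_psubset span_eq_iff)
    moreover have "A *v x \<in> V'" if "x \<in> V'" for x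
      using that less.prems(2) symmetric_inner_matrix_vector[OF sym, of u x] u
      by (auto simp: V'_def)
    ultimately obtain B l where B: "finite B" "B \<subseteq> V'" "pairwise orthogonal B"
      "\<forall>b\<in>B. norm b = 1 \<and> A *v b = l b *\<^sub>R b" "V' \<subseteq> span B"
      using less.hyps[OF _ V'] by blast
    have "u \<notin> B" using B(2) uu by (auto simp: V'_def)
    have "x \<in> span (insert u B)" if "x \<in> V" for x
    proof -
      have "x - (u \<bullet> x) *\<^sub>R u \<in> V'"
        using that u less.prems(1) uu
        by (auto simp: V'_def subspace_diff subspace_scale inner_diff_right)
      with B(5) show ?thesis by (auto simp: span_insert)
    qed
    moreover have "pairwise orthogonal (insert u B)"
      using B(2,3) by (auto simp: pairwise_insert V'_def orthogonal_def inner_commute)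
    moreover have "insert u B \<subseteq> V" using B(2) u by (auto simp: V'_def)
    ultimately show ?thesis
      using B(1,4) u \<open>u \<notin> B\<close>
      by (intro exI[of _ "insert u B"] exI[of _ "l(u := k)"]) auto
  qed
qed

lemma symmetric_eigenbasis:
  fixes A :: "real^'d^'d"
  assumes "transpose A = A"
  obtains B l where "finite B" "pairwise orthogonal B" "span B = UNIV"
    "\<And>b. b \<in> B \<Longrightarrow> norm b = 1" "\<And>b. b \<in> B \<Longrightarrow> A *v b = l b *\<^sub>R b"
  using symmetric_eigenbasis_subspace[OF assms, of UNIV] by (auto simp: top.extremum_unique)

section \<open>Square roots of positive semidefinite matrices\<close>

text \<open>With r = sqrt l, (R + r)(R - r) b = 0, so w = R b - r b satisfies R w = -r w. Positive
  semidefiniteness forces w = 0 when r > 0; when r = 0, |w|^2 = b.RRb = 0.\<close>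

lemma pos_semidef_sqrt_eigenvector:
  assumes R: "pos_semidef R" and eig: "(R ** R) *v b = l *\<^sub>R b" and "0 \<le> l"
  shows "R *v b = sqrt l *\<^sub>R b"
proof -
  have sym: "transpose R = R" using R by (simp add: pos_semidef_def)
  define r where "r = sqrt l"
  have r: "0 \<le> r" "r * r = l" using \<open>0 \<le> l\<close> by (auto simp: r_def)
  have RR: "R *v (R *v b) = (r * r) *\<^sub>R b" using eig r by (simp add: matrix_vector_mul_assoc)
  define w where "w = R *v b - r *\<^sub>R b"
  have Rw: "R *v w = - (r *\<^sub>R w)"
    by (simp add: w_def matrix_vector_mult_diff_distrib matrix_vector_mult_scaleR RR algebra_simps)
  have "w \<bullet> (R *v w) \<ge> 0" using R by (simp add: pos_semidef_def)
  then have "r * (w \<bullet> w) \<le> 0" by (simp add: Rw)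
  moreover have "w \<bullet> w = 0" if "r = 0"
  proof -
    have "w \<bullet> w = b \<bullet> (R *v (R *v b))"
      using that symmetric_inner_matrix_vector[OF sym, of b "R *v b"] by (simp add: w_def)
    then show ?thesis using that by (simp add: RR)
  qed
  ultimately have "w \<bullet> w = 0"
    using r(1) by (metis inner_ge_zero linorder_not_le mult_pos_pos order_le_less)
  then show ?thesis by (simp add: w_def r_def)
qed

text \<open>The root multiplies each vector of an orthonormal eigenbasis of \<open>A\<close> by the
  square root of its eigenvalue, which is nonnegative.\<close>

lemma pos_semidef_sqrt_exists:
  assumes A: "pos_semidef A"
  shows "\<exists>R. pos_semidef R \<and> R ** R = A"
proof -
  obtain B l where B: "finite B" "pairwise orthogonal B" "span B = UNIV"
    "\<And>b. b \<in> B \<Longrightarrow> norm b = 1" "\<And>b. b \<in> B \<Longrightarrow> A *v b = l b *\<^sub>R b"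
    using symmetric_eigenbasis A unfolding pos_semidef_def by metis
  have l: "0 \<le> l b" if "b \<in> B" for b
  proof -
    have "0 \<le> b \<bullet> (A *v b)" using A by (simp add: pos_semidef_def)
    then show ?thesis using B(4,5)[OF that] by (simp add: dot_square_norm)
  qed
  define R where "R = matrix (\<lambda>x. \<Sum>b\<in>B. (sqrt (l b) * (b \<bullet> x)) *\<^sub>R b)"
  have "linear (\<lambda>x. \<Sum>b\<in>B. (sqrt (l b) * (b \<bullet> x)) *\<^sub>R b)"
    by (intro linear_compose_sum ballI linearI) (auto simp: inner_add_right algebra_simps)
  then have Rx: "R *v x = (\<Sum>b\<in>B. (sqrt (l b) * (b \<bullet> x)) *\<^sub>R b)" for x
    by (simp add: R_def matrix_works)
  have "R *v c = sqrt (l c) *\<^sub>R c" if "c \<in> B" for c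
  proof -
    have "R *v c = (\<Sum>b\<in>B. if b = c then sqrt (l c) *\<^sub>R c else 0)"
      unfolding Rx using B(2,4) that
      by (intro sum.cong) (auto simp: pairwise_def orthogonal_def dot_square_norm)
    then show ?thesis using B(1) that by simp
  qed
  then have "(R ** R) *v c = A *v c" if "c \<in> B" for c
    using that B(5) l by (simp add: matrix_vector_mul_assoc[symmetric] matrix_vector_mult_scaleR)
  then have "(R ** R) *v x = A *v x" for x
    using linear_eq_on_span[of "(*v) (R ** R)" "(*v) A" B x] B(3) by auto
  moreover have "y \<bullet> (R *v x) = x \<bullet> (R *v y)" for x y
    by (simp add: Rx inner_sum_right inner_commute mult_ac)
  then have "transpose R = R"
    by (metis adjoint_matrix adjoint_unique inner_commute matrix_eq)
  moreover have "0 \<le> x \<bullet> (R *v x)" for x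
    using l by (simp add: Rx inner_sum_right inner_commute mult.assoc sum_nonneg)
  ultimately show ?thesis by (auto simp: pos_semidef_def matrix_eq)
qed

text \<open>On an eigenbasis of \<open>T\<close> with T b = l b, the common square acts as l^2, so
  both roots must act as sqrt (l^2).\<close>

lemma pos_semidef_sqrt_unique:
  assumes R: "pos_semidef R" and T: "pos_semidef T" and eq: "R ** R = T ** T"
  shows "R = T"
proof -
  have sym: "transpose T = T" using T by (simp add: pos_semidef_def)
  obtain B l where B: "span B = UNIV" "\<And>b. b \<in> B \<Longrightarrow> norm b = 1"
    "\<And>b. b \<in> B \<Longrightarrow> T *v b = l b *\<^sub>R b"
    using symmetric_eigenbasis[OF sym] by metis
  have "R *v b = T *v b" if "b \<in> B" for b
  proof -
    have TT: "(T ** T) *v b = (l b * l b) *\<^sub>R b"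
      using B(3)[OF that] by (simp add: matrix_vector_mul_assoc[symmetric] matrix_vector_mult_scaleR)
    then show ?thesis
      using pos_semidef_sqrt_eigenvector[OF T TT] pos_semidef_sqrt_eigenvector[OF R, of b "l b * l b"]
      by (simp add: eq)
  qed
  then have "R *v x = T *v x" for x
    using linear_eq_on_span[of "(*v) R" "(*v) T" B x] B(1) by auto
  then show ?thesis by (simp add: matrix_eq)
qed

lemma mat_sqrt_eqI:
  assumes "pos_semidef R" "R ** R = A"
  shows "mat_sqrt A = R"
  unfolding mat_sqrt_def using assms pos_semidef_sqrt_unique by blast

lemma
  assumes "pos_semidef A"
  shows pos_semidef_mat_sqrt: "pos_semidef (mat_sqrt A)"
    and mat_sqrt_mult_self: "mat_sqrt A ** mat_sqrt A = A"
  using pos_semidef_sqrt_exists[OF assms] mat_sqrt_eqI by metis+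

section \<open>The trace inner product of matrices\<close>

lemma inner_matrix_eq_trace:
  fixes A B :: "real^'n^'m"
  shows "A \<bullet> B = trace (transpose A ** B)"
  unfolding inner_vec_def trace_def matrix_matrix_mult_def transpose_def
  by (simp, rule sum.swap)

text \<open>Pairing with a fixed matrix turns a matrix-valued second moment into the expectation of
  a quadratic form.\<close>

lemma inner_outer_product: "M \<bullet> outer_product u v = u \<bullet> (M *v v)"
  by (simp add: inner_vec_def outer_product_def matrix_vector_mult_def sum_distrib_left mult_ac)

text \<open>Cauchy-Schwarz for the identity and \<open>R\<close> in the trace inner product. For
  \<open>R\<close> the root of a covariance \<open>S\<close> it gives tr S \<ge> d s^2, where d s =
  tr R.\<close>

lemma trace_square_le:
  fixes R :: "real^'d^'d"
  assumes "transpose R = R"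
  shows "(trace R)\<^sup>2 \<le> real CARD('d) * trace (R ** R)"
proof -
  have "(trace R)\<^sup>2 = (mat 1 \<bullet> R)\<^sup>2"
    by (simp add: inner_matrix_eq_trace transpose_mat)
  also have "\<dots> \<le> (mat 1 \<bullet> (mat 1 :: real^'d^'d)) * (R \<bullet> R)"
    by (rule Cauchy_Schwarz_ineq)
  also have "\<dots> = real CARD('d) * trace (R ** R)"
    by (simp add: inner_matrix_eq_trace transpose_mat assms trace_I)
  finally show ?thesis .
qed

section \<open>Measurability of the matrix square root\<close>

text \<open>For fixed \<open>v\<close>, v.Av is the inner product of \<open>A\<close> with a fixed
  matrix and so is continuous in \<open>A\<close>; the set is an intersection of closed
  conditions.\<close>

lemma closed_pos_semidef: "closed {A :: real^'d^'d. pos_semidef A}"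
proof -
  have "{A :: real^'d^'d. pos_semidef A} =
    {A. transpose A = A} \<inter> (\<Inter>v. {A. 0 \<le> A \<bullet> outer_product v v})"
    by (auto simp: pos_semidef_def inner_outer_product)
  moreover have "continuous_on UNIV (transpose :: real^'d^'d \<Rightarrow> real^'d^'d)"
    unfolding transpose_def by (intro continuous_intros)
  ultimately show ?thesis
    by (auto intro!: closed_Int closed_INT closed_Collect_eq closed_Collect_le continuous_intros)
qed

text \<open>Squaring is injective and continuous on the compact sets of positive semidefinite matrices
  of norm at most \<open>k\<close>, hence its inverse is continuous on their images.\<close>

lemma borel_measurable_mat_sqrt:
  "mat_sqrt \<in> borel_measurable (restrict_space borel {A :: real^'d^'d. pos_semidef A})"
proof -
  define K :: "nat \<Rightarrow> (real^'d^'d) set" where "K k = {A. pos_semidef A} \<inter> cball 0 (real k)" for k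
  define sq :: "real^'d^'d \<Rightarrow> real^'d^'d" where "sq R = R ** R" for R
  have K: "compact (K k)" for k
    unfolding K_def by (intro closed_Int_compact closed_pos_semidef compact_cball)
  have cont: "continuous_on S sq" for S
    unfolding sq_def matrix_matrix_mult_def by (intro continuous_intros)
  have inv: "continuous_on (sq ` K k) mat_sqrt" for k
    by (rule continuous_on_inv[OF cont K]) (auto simp: K_def sq_def intro: mat_sqrt_eqI)
  have closed: "closed (sq ` K k)" for k
    by (intro compact_imp_closed compact_continuous_image cont K)
  have psd: "pos_semidef (sq R)" if "pos_semidef R" for R
  proof -
    have sym: "transpose R = R" using that by (simp add: pos_semidef_def)
    have "v \<bullet> (sq R *v v) = (R *v v) \<bullet> (R *v v)" for v
      by (metis matrix_vector_mul_assoc sq_def sym symmetric_inner_matrix_vector)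
    then show ?thesis
      using sym by (simp add: pos_semidef_def sq_def matrix_transpose_mul)
  qed
  show ?thesis
  proof (rule measurable_piecewise_restrict[where C="range (\<lambda>k. sq ` K k)"])
    show "\<Omega> \<inter> space (restrict_space borel {A. pos_semidef A}) \<in> sets (restrict_space borel {A. pos_semidef A})"
      if "\<Omega> \<in> range (\<lambda>k. sq ` K k)" for \<Omega>
      using that closed closed_pos_semidef
      by (auto simp: sets_restrict_space space_restrict_space Int_commute intro!: imageI)
    show "space (restrict_space borel {A. pos_semidef A}) \<subseteq> \<Union> (range (\<lambda>k. sq ` K k))"
    proof
      fix A :: "real^'d^'d" assume "A \<in> space (restrict_space borel {A. pos_semidef A})"
      then have A: "pos_semidef A" by (simp add: space_restrict_space)
      obtain k :: nat where "norm (mat_sqrt A) \<le> real k" using real_arch_simple by blast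
      then have "A \<in> sq ` K k"
        using pos_semidef_mat_sqrt[OF A] mat_sqrt_mult_self[OF A]
        by (intro image_eqI[of _ _ "mat_sqrt A"]) (auto simp: sq_def K_def)
      then show "A \<in> \<Union> (range (\<lambda>k. sq ` K k))" by blast
    qed
    fix \<Omega> assume "\<Omega> \<in> range (\<lambda>k. sq ` K k)"
    then obtain k where k: "\<Omega> = sq ` K k" by blast
    then have "{A. pos_semidef A} \<inter> \<Omega> = sq ` K k" using psd by (auto simp: K_def)
    then show "mat_sqrt \<in> borel_measurable (restrict_space (restrict_space borel {A. pos_semidef A}) \<Omega>)"
      using borel_measurable_continuous_on_restrict[OF inv[of k]]
      by (simp add: restrict_restrict_space closed_pos_semidef k closed)
  qed simp
qed

section \<open>The Wasserstein loss through couplings\<close>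

abbreviation law :: "(real^'d \<Rightarrow> real) \<Rightarrow> (real^'d) measure" where
  "law p \<equiv> density lborel (\<lambda>y. ennreal (p y))"

lemma ennsqrt_square: "(ennsqrt c)\<^sup>2 = c"
proof (cases "c = \<infinity>")
  case False
  then show ?thesis
    by (simp add: ennsqrt_def ennreal_power less_top)
qed (simp add: ennsqrt_def ennreal_top_eq_mult_iff power2_eq_square)

lemma ennsqrt_mono: "a \<le> b \<Longrightarrow> ennsqrt a \<le> ennsqrt b"
  by (auto simp: ennsqrt_def top_unique less_top intro!: ennreal_leI enn2real_mono)

lemma W2_loss_le:
  assumes "\<gamma> \<in> couplings (law p) (law q)"
  shows "W2_loss p q \<le> (\<integral>\<^sup>+ (x, y). ennreal ((norm (x - y))\<^sup>2) \<partial>\<gamma>)"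
proof -
  let ?c = "\<integral>\<^sup>+ (x, y). ennreal ((norm (x - y))\<^sup>2) \<partial>\<gamma>"
  have "W2 (law p) (law q) \<le> ennsqrt ?c"
    unfolding W2_def by (rule INF_lower[OF assms])
  then have "(W2 (law p) (law q))\<^sup>2 \<le> (ennsqrt ?c)\<^sup>2" by (rule power_mono) simp
  then show ?thesis by (simp add: W2_loss_def ennsqrt_square)
qed

text \<open>As \<open>ennsqrt\<close> is monotone, a common lower bound of all transport costs
  passes through the infimum in \<open>W2\<close>, and squaring then undoes the root.\<close>

lemma le_W2_loss:
  assumes "\<And>\<gamma>. \<gamma> \<in> couplings (law p) (law q) \<Longrightarrow> e \<le> (\<integral>\<^sup>+ (x, y). ennreal ((norm (x - y))\<^sup>2) \<partial>\<gamma>)"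
  shows "e \<le> W2_loss p q"
proof -
  have "ennsqrt e \<le> W2 (law p) (law q)"
    unfolding W2_def by (intro INF_greatest ennsqrt_mono assms)
  then have "(ennsqrt e)\<^sup>2 \<le> (W2 (law p) (law q))\<^sup>2" by (rule power_mono) simp
  then show ?thesis by (simp add: W2_loss_def ennsqrt_square)
qed

section \<open>Moments and covariance matrices of densities\<close>

lemma prob_density_measurable [measurable_dest]:
  "prob_density p \<Longrightarrow> p \<in> borel_measurable borel"
  by (auto simp: prob_density_def has_bochner_integral_iff dest: borel_measurable_integrable)

lemma has_bochner_integral_nonneg_real:
  fixes f :: "'a \<Rightarrow> real"
  assumes "has_bochner_integral M f x" "\<And>w. 0 \<le> f w"
  shows "0 \<le> x"
  using assms by (metis has_bochner_integral_integral_eq Bochner_Integration.integral_nonneg)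

lemma has_bochner_integral_law:
  fixes g :: "real^'d \<Rightarrow> 'b::{banach, second_countable_topology}"
  assumes "prob_density p" "g \<in> borel_measurable borel"
    "has_bochner_integral lborel (\<lambda>y. p y *\<^sub>R g y) v"
  shows "has_bochner_integral (law p) g v"
  using assms prob_density_measurable[OF assms(1)]
  by (intro has_bochner_integral_density) (auto simp: prob_density_def)

lemma has_bochner_integral_law_const:
  assumes "prob_density p"
  shows "has_bochner_integral (law p) (\<lambda>_. c::real) c"
  using has_bochner_integral_mult_left[of c lborel p 1] assms
  by (intro has_bochner_integral_law) (auto simp: prob_density_def)

lemma continuous_outer_product: "continuous_on S (\<lambda>v. outer_product v v)"
  unfolding outer_product_def by (intro continuous_intros)

lemma borel_measurable_outer_product [measurable]:
  "(\<lambda>v. outer_product v v) \<in> borel_measurable borel"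
  by (intro borel_measurable_continuous_onI continuous_outer_product)

lemma outer_product_mult_vector: "outer_product u v *v y = (v \<bullet> y) *\<^sub>R u"
  by (simp add: vec_eq_iff outer_product_def matrix_vector_mult_def inner_vec_def sum_distrib_right
      sum_distrib_left mult_ac)

lemma symmetric_of_outer_product_integral:
  assumes "has_bochner_integral M (\<lambda>w. g w *\<^sub>R outer_product (V w) (V w)) S"
  shows "transpose S = S"
proof -
  have "has_bochner_integral M (\<lambda>w. g w * (V w $ i * V w $ j)) (S $ i $ j)" for i j
    using has_bochner_integral_bounded_linear[OF bounded_linear_vec_nth,
        OF has_bochner_integral_bounded_linear[OF bounded_linear_vec_nth, OF assms, of i], of j]
    by (simp add: outer_product_def)
  from this[of i j for i j] this[of j i for i j] have "S $ i $ j = S $ j $ i" for i j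
    by (subst (asm) (2) mult.commute) (rule has_bochner_integral_eq)
  then show ?thesis by (simp add: transpose_def vec_eq_iff)
qed

text \<open>A density gives no mass to hyperplanes, so no direction has zero variance.\<close>

lemma covariance_pos_def:
  assumes p: "prob_density p" and S: "has_mean_covariance p m S" and v: "v \<noteq> 0"
  shows "0 < v \<bullet> (S *v v)"
proof -
  note [measurable] = prob_density_measurable[OF p]
  have nonneg: "0 \<le> p y" for y using p by (simp add: prob_density_def)
  have I: "has_bochner_integral lborel (\<lambda>y. p y * (v \<bullet> (y - m))\<^sup>2) (v \<bullet> (S *v v))"
  proof -
    have "outer_product v v \<bullet> outer_product y y = (v \<bullet> y)\<^sup>2" for y
      by (simp add: inner_outer_product outer_product_mult_vector power2_eq_square inner_commute[of y])
    moreover have "outer_product v v \<bullet> S = v \<bullet> (S *v v)"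
      by (subst inner_commute) (rule inner_outer_product)
    ultimately show ?thesis
      using has_bochner_integral_inner_right[of "outer_product v v" lborel
          "\<lambda>y. p y *\<^sub>R outer_product (y - m) (y - m)" S] S
      by (simp add: has_mean_covariance_def)
  qed
  have "v \<bullet> (S *v v) \<noteq> 0"
  proof
    assume "v \<bullet> (S *v v) = 0"
    with I have "AE y in lborel. p y * (v \<bullet> (y - m))\<^sup>2 = 0"
      using nonneg by (subst integral_nonneg_eq_0_iff_AE[symmetric]) (auto simp: has_bochner_integral_iff)
    moreover have "{y. v \<bullet> y = v \<bullet> m} \<in> null_sets lborel"
    proof -
      have "closed {y. v \<bullet> y = v \<bullet> m}" by (rule closed_hyperplane)
      then show ?thesis
        using negligible_hyperplane[of v "v \<bullet> m"] v
        by (simp add: negligible_iff_null_sets null_sets_completion_iff)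
    qed
    then have "AE y in lborel. v \<bullet> y \<noteq> v \<bullet> m" by (auto dest: AE_not_in)
    ultimately have "AE y in lborel. p y = 0"
      by eventually_elim (auto simp: inner_diff_right)
    then have "integral\<^sup>L lborel p = 0" by (simp add: integral_eq_zero_AE)
    then show False using p by (simp add: prob_density_def has_bochner_integral_iff)
  qed
  moreover have "0 \<le> v \<bullet> (S *v v)"
    using nonneg by (intro has_bochner_integral_nonneg_real[OF I]) simp
  ultimately show ?thesis by simp
qed

text \<open>Strict positivity of the quadratic form makes the kernel trivial. Invertibility later
  keeps the estimated scale positive and lets the root of \<open>S\<close> be inverted in the
  correlation bound.\<close>

lemma
  assumes p: "prob_density p" and S: "has_mean_covariance p m S"
  shows pos_semidef_covariance: "pos_semidef S"
    and invertible_covariance: "invertible S"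
proof -
  note pos = covariance_pos_def[OF p S]
  show "pos_semidef S"
    unfolding pos_semidef_def
  proof (intro conjI allI)
    show "transpose S = S"
      using symmetric_of_outer_product_integral[of lborel p "\<lambda>y. y - m" S] S
      by (simp add: has_mean_covariance_def)
    show "0 \<le> v \<bullet> (S *v v)" for v
      using pos[of v] by (cases "v = 0") auto
  qed
  have "x = 0" if "S *v x = 0" for x
    using pos[of x] that by force
  then show "invertible S"
    by (auto simp: invertible_left_inverse matrix_left_invertible_ker)
qed

section \<open>Trace and correlation estimates for coupled vectors\<close>

text \<open>The trace is the squared norm of the fourth root \<open>T\<close> of \<open>S\<close>,
  and T = 0 would make the invertible matrix \<open>S\<close> zero.\<close>

lemma trace_mat_sqrt_pos:
  fixes S :: "real^'d^'d"
  assumes S: "pos_semidef S" "invertible S"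
  shows "0 < trace (mat_sqrt S)"
proof -
  note R = pos_semidef_mat_sqrt[OF S(1)]
  define T where "T = mat_sqrt (mat_sqrt S)"
  have "transpose T = T" using pos_semidef_mat_sqrt[OF R] by (simp add: T_def pos_semidef_def)
  then have "trace (mat_sqrt S) = T \<bullet> T"
    using mat_sqrt_mult_self[OF R] by (simp add: inner_matrix_eq_trace T_def)
  moreover have "T \<noteq> 0"
  proof
    assume "T = 0"
    then have "mat_sqrt S = 0" using mat_sqrt_mult_self[OF R] by (simp add: T_def)
    then have "S = 0" using mat_sqrt_mult_self[OF S(1)] by simp
    then have "(mat 1 :: real^'d^'d) = 0" using S(2) by (auto simp: invertible_def)
    then show False using trace_I[where 'n='d and 'a=real] by (simp add: trace_def)
  qed
  ultimately show ?thesis by simp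
qed

text \<open>With \<open>W = R\<^sup>-\<^sup>1 V\<close>, also standardized, the bound on the correlation of \<open>Z\<close> and \<open>V = R W\<close> is
  the expectation of \<open>0 \<le> (Z - W) \<bullet> R (Z - W)\<close>.\<close>

lemma correlation_le_trace_sqrt:
  fixes Z V :: "'a \<Rightarrow> real^'d"
  assumes one: "has_bochner_integral M (\<lambda>_. 1::real) 1"
    and Z: "has_bochner_integral M Z 0" "has_bochner_integral M (\<lambda>w. outer_product (Z w) (Z w)) (mat 1)"
    and V: "has_bochner_integral M V 0" "has_bochner_integral M (\<lambda>w. outer_product (V w) (V w)) S"
    and R: "pos_semidef R" "R ** R = S" and S: "invertible S"
  obtains c where "c \<le> trace R"
    "\<And>a \<sigma>. has_bochner_integral M (\<lambda>w. (norm (a + \<sigma> *\<^sub>R Z w - V w))\<^sup>2)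
        ((norm a)\<^sup>2 + \<sigma>\<^sup>2 * real CARD('d) + trace S - 2 * \<sigma> * c)"
proof -
  have [measurable]: "Z \<in> borel_measurable M" "V \<in> borel_measurable M"
    using Z V by (auto simp: has_bochner_integral_iff dest: borel_measurable_integrable)
  have quad_Z: "has_bochner_integral M (\<lambda>w. Z w \<bullet> (A *v Z w)) (trace A)" for A
    using has_bochner_integral_inner_right[OF Z(2), of A]
    by (simp add: inner_outer_product inner_matrix_eq_trace[of "mat 1"] inner_commute[of A "mat 1"] transpose_mat)
  have quad_V: "has_bochner_integral M (\<lambda>w. V w \<bullet> (A *v V w)) (A \<bullet> S)" for A
    using has_bochner_integral_inner_right[OF V(2), of A] by (simp add: inner_outer_product)
  have ZZ: "has_bochner_integral M (\<lambda>w. Z w \<bullet> Z w) (real CARD('d))"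
    using quad_Z[of "mat 1"] by (simp add: trace_I)
  have VV: "has_bochner_integral M (\<lambda>w. V w \<bullet> V w) (trace S)"
    using quad_V[of "mat 1"] by (simp add: inner_matrix_eq_trace transpose_mat)
  have "integrable M (\<lambda>w. Z w \<bullet> V w)"
  proof (rule Bochner_Integration.integrable_bound)
    show "integrable M (\<lambda>w. Z w \<bullet> Z w + V w \<bullet> V w)"
      using ZZ VV by (auto simp: has_bochner_integral_iff)
    have "\<bar>z \<bullet> v\<bar> \<le> z \<bullet> z + v \<bullet> v" for z v :: "real^'d"
    proof -
      have "0 \<le> (z + v) \<bullet> (z + v)" "0 \<le> (z - v) \<bullet> (z - v)" "0 \<le> z \<bullet> z" "0 \<le> v \<bullet> v" by simp_all
      then show ?thesis
        by (simp add: inner_add_left inner_add_right inner_diff_left inner_diff_right inner_commute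
            del: inner_ge_zero)
    qed
    then show "AE w in M. norm (Z w \<bullet> V w) \<le> norm (Z w \<bullet> Z w + V w \<bullet> V w)"
      by (auto intro: order_trans)
  qed simp
  then obtain c where c: "has_bochner_integral M (\<lambda>w. Z w \<bullet> V w) c"
    by (auto simp: has_bochner_integral_iff)
  have symR: "transpose R = R" using R by (simp add: pos_semidef_def)
  have "\<exists>T. T ** R = mat 1"
    using S R(2) by (auto simp: invertible_def matrix_mul_assoc)
  then obtain T where TR: "T ** R = mat 1" by blast
  then have RTm: "R ** T = mat 1" by (simp add: matrix_left_right_inverse)
  have symT: "transpose T = T"
  proof -
    have "transpose T = transpose T ** (R ** T)" by (simp add: RTm)
    also have "\<dots> = transpose (R ** T) ** T"
      by (simp add: matrix_transpose_mul symR matrix_mul_assoc)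
    finally show ?thesis by (simp add: RTm transpose_mat)
  qed
  have RT: "R *v (T *v v) = v" for v
    by (simp add: matrix_vector_mul_assoc RTm)
  have TS: "T \<bullet> S = trace R"
    by (simp add: inner_matrix_eq_trace symT R(2)[symmetric] matrix_mul_assoc TR)
  \<comment> \<open>With W = T V and R W = V, the integrand is (Z - W).R(Z - W). Its last term has
    expectation tr (T S) = tr R, because S = R R and \<open>T\<close> inverts
    \<open>R\<close>.\<close>
  have "has_bochner_integral M (\<lambda>w. Z w \<bullet> (R *v Z w) - 2 * (Z w \<bullet> V w) + V w \<bullet> (T *v V w))
      (trace R - 2 * c + trace R)"
    using quad_V[of T] unfolding TS
    by (intro has_bochner_integral_add has_bochner_integral_diff quad_Z has_bochner_integral_mult_right c)
  moreover have "0 \<le> z \<bullet> (R *v z) - 2 * (z \<bullet> v) + v \<bullet> (T *v v)" for z v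
  proof -
    have "0 \<le> (z - T *v v) \<bullet> (R *v (z - T *v v))" using R(1) by (simp add: pos_semidef_def)
    moreover have "(T *v v) \<bullet> (R *v z) = v \<bullet> z"
      by (simp add: symmetric_inner_matrix_vector[OF symR] RT)
    ultimately show ?thesis
      by (simp add: matrix_vector_mult_diff_distrib RT inner_diff_left inner_diff_right inner_commute)
  qed
  ultimately have "0 \<le> trace R - 2 * c + trace R"
    by (rule has_bochner_integral_nonneg_real)
  then have "c \<le> trace R" by simp
  moreover have "has_bochner_integral M (\<lambda>w. (norm (a + \<sigma> *\<^sub>R Z w - V w))\<^sup>2)
      ((norm a)\<^sup>2 + \<sigma>\<^sup>2 * real CARD('d) + trace S - 2 * \<sigma> * c)" for a \<sigma>
  proof -
    have "has_bochner_integral M (\<lambda>w. (norm a)\<^sup>2 * 1 + \<sigma>\<^sup>2 * (Z w \<bullet> Z w) + V w \<bullet> V w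
        + (2 * \<sigma>) * (a \<bullet> Z w) - 2 * (a \<bullet> V w) - (2 * \<sigma>) * (Z w \<bullet> V w))
      ((norm a)\<^sup>2 * 1 + \<sigma>\<^sup>2 * real CARD('d) + trace S + (2 * \<sigma>) * (a \<bullet> 0) - 2 * (a \<bullet> 0) - (2 * \<sigma>) * c)"
      by (intro has_bochner_integral_add has_bochner_integral_diff has_bochner_integral_mult_right
          has_bochner_integral_inner_right one ZZ VV Z V c)
    moreover have "(norm (a + \<sigma> *\<^sub>R z - v))\<^sup>2 = (norm a)\<^sup>2 * 1 + \<sigma>\<^sup>2 * (z \<bullet> z) + v \<bullet> v
        + (2 * \<sigma>) * (a \<bullet> z) - 2 * (a \<bullet> v) - (2 * \<sigma>) * (z \<bullet> v)" for z v
      unfolding power2_norm_eq_inner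
      by (simp add: inner_add_left inner_add_right inner_diff_left inner_diff_right
          inner_commute[of z a] inner_commute[of v a] inner_commute[of v z] power2_eq_square algebra_simps)
    ultimately show ?thesis by simp
  qed
  ultimately show ?thesis using that by blast
qed

text \<open>Jensen's inequality in its tangent form 2 D x - D^2 \<le> x^2, for x = \<phi> U - \<phi>
  Y with mean D = u - y. Integrating the left side involves only the first moment of x, and x^2 is
  at most |U - Y|^2.\<close>

lemma lipschitz_expectation_diff_le:
  fixes U Y :: "'a \<Rightarrow> 'b::real_normed_vector" and \<phi> :: "'b \<Rightarrow> real"
  assumes one: "has_bochner_integral M (\<lambda>_. 1::real) 1"
    and U: "has_bochner_integral M (\<lambda>w. \<phi> (U w)) u" and Y: "has_bochner_integral M (\<lambda>w. \<phi> (Y w)) y"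
    and E: "has_bochner_integral M (\<lambda>w. (norm (U w - Y w))\<^sup>2) e"
    and lip: "\<And>a b. \<bar>\<phi> a - \<phi> b\<bar> \<le> norm (a - b)"
  shows "(u - y)\<^sup>2 \<le> e"
proof -
  let ?D = "u - y"
  have "has_bochner_integral M (\<lambda>w. 2 * ?D * (\<phi> (U w) - \<phi> (Y w)) - ?D\<^sup>2 * 1) (2 * ?D * ?D - ?D\<^sup>2 * 1)"
    by (intro has_bochner_integral_diff has_bochner_integral_mult_right one U Y)
  moreover have "2 * ?D * (\<phi> (U w) - \<phi> (Y w)) - ?D\<^sup>2 * 1 \<le> (norm (U w - Y w))\<^sup>2" for w
  proof -
    have "0 \<le> (?D - (\<phi> (U w) - \<phi> (Y w)))\<^sup>2" by simp
    also have "\<dots> = ?D\<^sup>2 - 2 * ?D * (\<phi> (U w) - \<phi> (Y w)) + (\<phi> (U w) - \<phi> (Y w))\<^sup>2"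
      by (simp add: power2_diff)
    finally show ?thesis
      using power_mono[OF lip[of "U w" "Y w"], of 2] by simp
  qed
  ultimately have "0 \<le> e - (2 * ?D * ?D - ?D\<^sup>2 * 1)"
    by (intro has_bochner_integral_nonneg_real[OF has_bochner_integral_diff[OF E]]) (auto simp: diff_ge_0_iff_ge)
  moreover have "2 * ?D * ?D - ?D\<^sup>2 * 1 = ?D\<^sup>2" by (simp add: power2_eq_square algebra_simps)
  ultimately show ?thesis by simp
qed

section \<open>Location-scale laws and bounds for the loss\<close>

text \<open>The affine substitution scales Lebesgue measure by \<sigma>^d, which cancels the
  normalizing factor of \<open>loc_scale\<close>.\<close>

lemma law_loc_scale:
  fixes f :: "real^'d \<Rightarrow> real"
  assumes f: "prob_density f" and \<sigma>: "0 < \<sigma>"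
  shows "law (loc_scale f \<mu> \<sigma>) = distr (law f) borel (\<lambda>z. \<mu> + \<sigma> *\<^sub>R z)"
proof -
  note [measurable] = prob_density_measurable[OF f]
  let ?T = "\<lambda>z. \<mu> + \<sigma> *\<^sub>R z :: real^'d"
  have nonneg: "0 \<le> f z" for z using f by (simp add: prob_density_def)
  have [measurable]: "loc_scale f \<mu> \<sigma> \<in> borel_measurable borel"
    unfolding loc_scale_def by measurable
  have "law (loc_scale f \<mu> \<sigma>) =
      density (density (distr lborel borel ?T) (\<lambda>_. \<bar>\<sigma>\<bar> ^ DIM(real^'d))) (\<lambda>y. ennreal (loc_scale f \<mu> \<sigma> y))"
    using \<sigma> by (subst lborel_affine[of \<sigma> \<mu>]) auto
  also have "\<dots> = density (distr lborel borel ?T) (\<lambda>y. ennreal (\<bar>\<sigma>\<bar> ^ DIM(real^'d)) * ennreal (loc_scale f \<mu> \<sigma> y))"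
    by (rule density_density_eq) auto
  also have "\<dots> = distr (density lborel (\<lambda>z. ennreal (\<bar>\<sigma>\<bar> ^ DIM(real^'d)) * ennreal (loc_scale f \<mu> \<sigma> (?T z)))) borel ?T"
    by (rule density_distr) auto
  also have "(\<lambda>z. ennreal (\<bar>\<sigma>\<bar> ^ DIM(real^'d)) * ennreal (loc_scale f \<mu> \<sigma> (?T z))) = (\<lambda>z. ennreal (f z))"
    using \<sigma> nonneg by (auto simp: loc_scale_def ennreal_mult[symmetric] fun_eq_iff)
  finally show ?thesis .
qed

text \<open>Carries moments of a marginal over to a coupling, where both coordinates live on one
  space.\<close>

lemma has_bochner_integral_comp:
  fixes g :: "'b \<Rightarrow> 'c::{banach, second_countable_topology}"
  assumes "distr M N X = L" "X \<in> measurable M N" "has_bochner_integral L g v"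
  shows "has_bochner_integral M (\<lambda>w. g (X w)) v"
proof -
  have "g \<in> borel_measurable N"
    using assms(1,3) by (auto simp: has_bochner_integral_iff dest!: borel_measurable_integrable)
  then show ?thesis
    using assms(3) integrable_distr_eq[OF assms(2)] integral_distr[OF assms(2)]
    unfolding assms(1)[symmetric] has_bochner_integral_iff by metis
qed

lemma prob_density_loc_scale:
  fixes f :: "real^'d \<Rightarrow> real"
  assumes f: "prob_density f" and \<sigma>: "0 < \<sigma>"
  shows "prob_density (loc_scale f \<mu> \<sigma>)"
proof -
  note [measurable] = prob_density_measurable[OF f]
  have [measurable]: "loc_scale f \<mu> \<sigma> \<in> borel_measurable borel"
    unfolding loc_scale_def by measurable
  have nonneg: "0 \<le> loc_scale f \<mu> \<sigma> z" for z
    using f \<sigma> by (simp add: prob_density_def loc_scale_def)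
  have "has_bochner_integral (law (loc_scale f \<mu> \<sigma>)) (\<lambda>_. 1::real) 1"
    unfolding law_loc_scale[OF f \<sigma>]
    by (intro has_bochner_integral_distr has_bochner_integral_law_const f) auto
  then have "has_bochner_integral lborel (loc_scale f \<mu> \<sigma>) 1"
    using nonneg integrable_density[of "\<lambda>_. 1::real" lborel "loc_scale f \<mu> \<sigma>"]
      integral_density[of "\<lambda>_. 1::real" lborel "loc_scale f \<mu> \<sigma>"]
    by (auto simp: has_bochner_integral_iff)
  with nonneg show ?thesis by (simp add: prob_density_def)
qed

lemma standardized_density_law:
  assumes "standardized_density f"
  shows "prob_density f" "has_bochner_integral (law f) (\<lambda>z. z) 0"
    "has_bochner_integral (law f) (\<lambda>z. outer_product z z) (mat 1)"
  using assms by (auto simp: standardized_density_def intro!: has_bochner_integral_law)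

text \<open>Both densities are laws of affine images of one vector Z with law \<open>law f\<close>.
  The difference of the images is (\<mu> - m) + (\<sigma> - s) Z, whose mean square follows from E Z
  = 0 and E |Z|^2 = d.\<close>

lemma W2_loss_loc_scale_le:
  fixes f :: "real^'d \<Rightarrow> real"
  assumes f: "standardized_density f" and \<sigma>: "0 < \<sigma>" "0 < s"
  shows "W2_loss (loc_scale f \<mu> \<sigma>) (loc_scale f m s)
    \<le> ennreal ((norm (\<mu> - m))\<^sup>2 + real CARD('d) * (\<sigma> - s)\<^sup>2)"
proof -
  note F = standardized_density_law[OF f]
  let ?T = "\<lambda>z. (\<mu> + \<sigma> *\<^sub>R z, m + s *\<^sub>R z)"
  let ?\<gamma> = "distr (law f) borel ?T"
  have [measurable]: "?T \<in> borel_measurable borel" "(fst :: (real^'d) \<times> (real^'d) \<Rightarrow> _) \<in> borel_measurable borel"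
      "(snd :: (real^'d) \<times> (real^'d) \<Rightarrow> _) \<in> borel_measurable borel"
    by (intro borel_measurable_continuous_onI continuous_intros)+
  have "?\<gamma> \<in> couplings (law (loc_scale f \<mu> \<sigma>)) (law (loc_scale f m s))"
    by (auto simp: couplings_def law_loc_scale[OF F(1) \<sigma>(1)] law_loc_scale[OF F(1) \<sigma>(2)] distr_distr comp_def)
  from W2_loss_le[OF this]
  have "W2_loss (loc_scale f \<mu> \<sigma>) (loc_scale f m s) \<le> (\<integral>\<^sup>+ (x, y). ennreal ((norm (x - y))\<^sup>2) \<partial>?\<gamma>)" .
  also have "\<dots> = (\<integral>\<^sup>+ z. ennreal ((norm ((\<mu> - m) + (\<sigma> - s) *\<^sub>R z))\<^sup>2) \<partial>law f)"
    by (subst nn_integral_distr) (auto simp: case_prod_beta algebra_simps)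
  also have "\<dots> = ennreal ((norm (\<mu> - m))\<^sup>2 + real CARD('d) * (\<sigma> - s)\<^sup>2)"
  proof -
    have zz: "has_bochner_integral (law f) (\<lambda>z. z \<bullet> z) (real CARD('d))"
      using has_bochner_integral_inner_right[OF F(3), of "mat 1"]
      by (simp add: inner_outer_product) (simp add: inner_matrix_eq_trace transpose_mat trace_I)
    have "has_bochner_integral (law f)
        (\<lambda>z. (norm (\<mu> - m))\<^sup>2 + (2 * (\<sigma> - s)) * ((\<mu> - m) \<bullet> z) + (\<sigma> - s)\<^sup>2 * (z \<bullet> z))
        ((norm (\<mu> - m))\<^sup>2 + (2 * (\<sigma> - s)) * ((\<mu> - m) \<bullet> 0) + (\<sigma> - s)\<^sup>2 * real CARD('d))"
      by (intro has_bochner_integral_add has_bochner_integral_mult_right has_bochner_integral_inner_right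
          has_bochner_integral_law_const F zz)
    moreover have "(norm (a + t *\<^sub>R z))\<^sup>2 = (norm a)\<^sup>2 + (2 * t) * (a \<bullet> z) + t\<^sup>2 * (z \<bullet> z)" for a z :: "real^'d" and t
      unfolding power2_norm_eq_inner
      by (simp add: inner_add_left inner_add_right inner_commute[of z a] power2_eq_square algebra_simps)
    ultimately have "has_bochner_integral (law f) (\<lambda>z. (norm ((\<mu> - m) + (\<sigma> - s) *\<^sub>R z))\<^sup>2)
        ((norm (\<mu> - m))\<^sup>2 + real CARD('d) * (\<sigma> - s)\<^sup>2)"
      by (simp add: mult.commute)
    then show ?thesis
      by (subst nn_integral_eq_integral) (auto simp: has_bochner_integral_iff)
  qed
  finally show ?thesis .
qed

text \<open>Let \<open>X\<close> and \<open>Y\<close> be coupled, \<open>Z = (X - \<mu>) / \<sigma>\<close>, \<open>s = tr S\<^sup>1\<^sup>/\<^sup>2 / d\<close> and \<open>c = E Z \<bullet> (Y - m)\<close>.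
  With the nonnegative numbers \<open>\<alpha> = tr S - d s\<^sup>2\<close> and \<open>\<beta> = d s - c\<close>, the cost of the coupling exceeds
  the loss of the plug-in density by \<open>\<alpha> + 2 \<sigma> \<beta>\<close>, while \<open>\<alpha> + 2 s \<beta>\<close> is the mean squared distance of
  \<open>m + s Z\<close>, which has the plug-in law, from \<open>Y\<close>.\<close>

lemma W2_loss_ge:
  fixes f q \<phi> :: "real^'d \<Rightarrow> real"
  defines "s \<equiv> \<lambda>S::real^'d^'d. trace (mat_sqrt S) / real CARD('d)"
  assumes f: "standardized_density f" and \<sigma>: "0 < \<sigma>"
    and q: "prob_density q" and S: "has_mean_covariance q m S"
    and lip: "\<And>a b. \<bar>\<phi> a - \<phi> b\<bar> \<le> norm (a - b)" and bound: "\<And>a. \<bar>\<phi> a\<bar> \<le> B"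
  shows "ennreal ((norm (\<mu> - m))\<^sup>2 + real CARD('d) * (\<sigma> - s S)\<^sup>2)
      + ennreal (min 1 (\<sigma> / s S) * ((\<integral>y. loc_scale f m (s S) y * \<phi> y \<partial>lborel) - (\<integral>y. q y * \<phi> y \<partial>lborel))\<^sup>2)
    \<le> W2_loss (loc_scale f \<mu> \<sigma>) q"
proof (rule le_W2_loss)
  let ?d = "real CARD('d)"
  note F = standardized_density_law[OF f]
  note psd = pos_semidef_covariance[OF q S] and inv = invertible_covariance[OF q S]
  define R where "R = mat_sqrt S"
  have R: "pos_semidef R" "R ** R = S"
    using pos_semidef_mat_sqrt[OF psd] mat_sqrt_mult_self[OF psd] by (auto simp: R_def)
  define t where "t = s S"
  have trR: "trace R = ?d * t" by (simp add: t_def s_def R_def)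
  have t: "0 < t"
    using trace_mat_sqrt_pos[OF psd inv] by (simp add: t_def s_def)
  fix \<gamma> assume "\<gamma> \<in> couplings (law (loc_scale f \<mu> \<sigma>)) (law q)"
  then have \<gamma>: "sets \<gamma> = sets borel" and fst: "distr \<gamma> borel fst = law (loc_scale f \<mu> \<sigma>)"
    and snd: "distr \<gamma> borel snd = law q"
    by (auto simp: couplings_def)
  have [measurable]: "(fst :: (real^'d) \<times> (real^'d) \<Rightarrow> _) \<in> borel_measurable \<gamma>"
      "(snd :: (real^'d) \<times> (real^'d) \<Rightarrow> _) \<in> borel_measurable \<gamma>"
    unfolding measurable_cong_sets[OF \<gamma> refl]
    by (intro borel_measurable_continuous_onI continuous_intros)+
  have "continuous_on UNIV \<phi>"
    unfolding continuous_on_iff dist_norm real_norm_def using lip le_less_trans by blast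
  then have [measurable]: "\<phi> \<in> borel_measurable borel"
    by (rule borel_measurable_continuous_onI)
  \<comment> \<open>Standardizing the first coordinate recovers a vector with law
    \<open>law f\<close>; \<open>U\<close> then realizes the plug-in law on the same space as the
    second coordinate.\<close>
  define Z where "Z w = (fst w - \<mu>) /\<^sub>R \<sigma>" for w :: "(real^'d) \<times> (real^'d)"
  have [measurable]: "Z \<in> borel_measurable \<gamma>" unfolding Z_def by measurable
  have "distr \<gamma> borel Z = distr (distr \<gamma> borel fst) borel (\<lambda>x. (x - \<mu>) /\<^sub>R \<sigma>)"
    by (subst distr_distr) (auto simp: comp_def Z_def[abs_def])
  also have "\<dots> = distr (law f) borel (\<lambda>z. z)"
    using \<sigma> unfolding fst law_loc_scale[OF F(1) \<sigma>] by (subst distr_distr) (auto simp: comp_def)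
  also have "\<dots> = law f" by (rule distr_id2) simp
  finally have Z: "distr \<gamma> borel Z = law f" .
  define U where "U w = m + t *\<^sub>R Z w" for w
  have [measurable]: "U \<in> borel_measurable \<gamma>" unfolding U_def by measurable
  have "distr \<gamma> borel U = distr (distr \<gamma> borel Z) borel (\<lambda>z. m + t *\<^sub>R z)"
    by (subst distr_distr) (auto simp: comp_def U_def[abs_def])
  then have U: "distr \<gamma> borel U = law (loc_scale f m t)"
    unfolding Z law_loc_scale[OF F(1) t] .
  have one: "has_bochner_integral \<gamma> (\<lambda>_. 1::real) 1"
    by (rule has_bochner_integral_comp[OF Z _ has_bochner_integral_law_const[OF F(1)]]) simp
  have V1: "has_bochner_integral (law q) (\<lambda>y. y - m) 0"
  proof -
    have "has_bochner_integral lborel (\<lambda>y. q y *\<^sub>R y - q y *\<^sub>R m) (m - 1 *\<^sub>R m)"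
      using q S by (intro has_bochner_integral_diff has_bochner_integral_scaleR_left)
        (auto simp: has_mean_covariance_def has_mean_def prob_density_def)
    then show ?thesis
      by (intro has_bochner_integral_law q) (simp_all add: scaleR_diff_right)
  qed
  have V2: "has_bochner_integral (law q) (\<lambda>y. outer_product (y - m) (y - m)) S"
    using S by (intro has_bochner_integral_law q) (auto simp: has_mean_covariance_def)
  obtain c where c: "c \<le> trace R"
    and E: "\<And>a \<sigma>. has_bochner_integral \<gamma> (\<lambda>w. (norm (a + \<sigma> *\<^sub>R Z w - (snd w - m)))\<^sup>2)
        ((norm a)\<^sup>2 + \<sigma>\<^sup>2 * ?d + trace S - 2 * \<sigma> * c)"
    by (rule correlation_le_trace_sqrt[OF one has_bochner_integral_comp[OF Z _ F(2)]
          has_bochner_integral_comp[OF Z _ F(3)] has_bochner_integral_comp[OF snd _ V1]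
          has_bochner_integral_comp[OF snd _ V2] R inv]) auto
  define P where "P = (\<integral>y. loc_scale f m t y * \<phi> y \<partial>lborel)"
  define Q where "Q = (\<integral>y. q y * \<phi> y \<partial>lborel)"
  have expect: "has_bochner_integral (law p) \<phi> (\<integral>y. p y * \<phi> y \<partial>lborel)" if p: "prob_density p" for p
  proof (rule has_bochner_integral_law[OF p])
    have "integrable lborel (\<lambda>y. p y * \<phi> y)"
    proof (rule Bochner_Integration.integrable_bound)
      show "integrable lborel (\<lambda>y. B * p y)"
        using p by (auto simp: prob_density_def has_bochner_integral_iff)
      show "AE y in lborel. norm (p y * \<phi> y) \<le> norm (B * p y)"
        using bound order_trans[OF abs_ge_zero bound]
        by (auto simp: abs_mult mult.commute[of "p _"] intro!: mult_right_mono)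
    qed (use prob_density_measurable[OF p] in measurable)
    then show "has_bochner_integral lborel (\<lambda>y. p y *\<^sub>R \<phi> y) (\<integral>y. p y * \<phi> y \<partial>lborel)"
      by (simp add: has_bochner_integral_iff)
  qed simp
  \<comment> \<open>Shift 0 and scale \<open>t\<close> in \<open>E\<close> give the mean square of
    the distance from \<open>U\<close> to the second coordinate.\<close>
  have "(P - Q)\<^sup>2 \<le> (norm (0::real^'d))\<^sup>2 + t\<^sup>2 * ?d + trace S - 2 * t * c"
  proof (rule lipschitz_expectation_diff_le[OF one _ _ _ lip])
    show "has_bochner_integral \<gamma> (\<lambda>w. \<phi> (U w)) P"
      unfolding P_def by (rule has_bochner_integral_comp[OF U _ expect[OF prob_density_loc_scale[OF F(1) t]]]) simp
    show "has_bochner_integral \<gamma> (\<lambda>w. \<phi> (snd w)) Q"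
      unfolding Q_def by (rule has_bochner_integral_comp[OF snd _ expect[OF q]]) simp
    show "has_bochner_integral \<gamma> (\<lambda>w. (norm (U w - snd w))\<^sup>2) ((norm (0::real^'d))\<^sup>2 + t\<^sup>2 * ?d + trace S - 2 * t * c)"
      using E[of 0 t] by (simp add: U_def algebra_simps)
  qed
  also have "\<dots> = (trace S - ?d * t\<^sup>2) + 2 * t * (trace R - c)"
    by (simp add: trR power2_eq_square algebra_simps)
  finally have PQ: "(P - Q)\<^sup>2 \<le> (trace S - ?d * t\<^sup>2) + 2 * t * (trace R - c)" .
  have "?d * (?d * t\<^sup>2) \<le> ?d * trace S"
    using trace_square_le[of R] R by (simp add: pos_semidef_def trR power2_eq_square mult_ac)
  then have \<alpha>: "0 \<le> trace S - ?d * t\<^sup>2" by simp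
  \<comment> \<open>The factor min(1, \<sigma>/t) is bounded by 1 on the first nonnegative summand
    and by \<sigma>/t on the second, which turns 2 t into 2 \<sigma>.\<close>
  have "min 1 (\<sigma> / t) * (P - Q)\<^sup>2 \<le> min 1 (\<sigma> / t) * ((trace S - ?d * t\<^sup>2) + 2 * t * (trace R - c))"
    using PQ \<sigma> t by (intro mult_left_mono) auto
  also have "\<dots> \<le> (trace S - ?d * t\<^sup>2) + 2 * \<sigma> * (trace R - c)"
  proof -
    have "min 1 (\<sigma> / t) * (trace S - ?d * t\<^sup>2) \<le> 1 * (trace S - ?d * t\<^sup>2)"
      using \<alpha> by (intro mult_right_mono) auto
    moreover have "min 1 (\<sigma> / t) * (2 * t * (trace R - c)) \<le> \<sigma> / t * (2 * t * (trace R - c))"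
      using t c by (intro mult_right_mono) auto
    moreover have "\<sigma> / t * (2 * t * (trace R - c)) = 2 * \<sigma> * (trace R - c)"
      using t by simp
    ultimately show ?thesis unfolding distrib_left by (metis add_mono mult_1)
  qed
  finally have key: "(norm (\<mu> - m))\<^sup>2 + ?d * (\<sigma> - t)\<^sup>2 + min 1 (\<sigma> / t) * (P - Q)\<^sup>2
      \<le> (norm (\<mu> - m))\<^sup>2 + \<sigma>\<^sup>2 * ?d + trace S - 2 * \<sigma> * c"
    by (simp add: trR power2_eq_square algebra_simps)
  have "(\<integral>\<^sup>+ (x, y). ennreal ((norm (x - y))\<^sup>2) \<partial>\<gamma>)
      = (\<integral>\<^sup>+ w. ennreal ((norm ((\<mu> - m) + \<sigma> *\<^sub>R Z w - (snd w - m)))\<^sup>2) \<partial>\<gamma>)"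
    using \<sigma> by (intro nn_integral_cong) (auto simp: Z_def)
  also have "\<dots> = ennreal ((norm (\<mu> - m))\<^sup>2 + \<sigma>\<^sup>2 * ?d + trace S - 2 * \<sigma> * c)"
    using E[of "\<mu> - m" \<sigma>] by (subst nn_integral_eq_integral) (auto simp: has_bochner_integral_iff)
  finally show "ennreal ((norm (\<mu> - m))\<^sup>2 + ?d * (\<sigma> - s S)\<^sup>2)
      + ennreal (min 1 (\<sigma> / s S) * ((\<integral>y. loc_scale f m (s S) y * \<phi> y \<partial>lborel) - (\<integral>y. q y * \<phi> y \<partial>lborel))\<^sup>2)
    \<le> (\<integral>\<^sup>+ (x, y). ennreal ((norm (x - y))\<^sup>2) \<partial>\<gamma>)"
    using ennreal_leI[OF key] \<sigma> t
    by (subst ennreal_plus[symmetric]) (simp_all add: P_def Q_def t_def del: ennreal_plus)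
qed

section \<open>Countable families of test functions separating densities\<close>

text \<open>The scaled functions \<open>k * min (1/k) (infdist x (- U))\<close> increase to the indicator of the
  open set \<open>U\<close>, and the countably many finite intersections of basic open sets generate the Borel
  sets.\<close>

lemma emeasure_law_eq_limit:
  fixes p :: "real^'d \<Rightarrow> real"
  assumes p: "prob_density p" and U: "open U" "U \<noteq> UNIV"
  shows "(\<lambda>k. ennreal (real (Suc k) * (\<integral>y. p y * min (1 / real (Suc k)) (infdist y (- U)) \<partial>lborel)))
    \<longlonglongrightarrow> emeasure (law p) U"
proof -
  note [measurable] = prob_density_measurable[OF p]
  have nonneg: "0 \<le> p y" for y
    using p by (simp add: prob_density_def)
  have int: "integrable lborel p"
    using p by (simp add: prob_density_def has_bochner_integral_iff)
  have [measurable]: "(\<lambda>y. infdist y (- U)) \<in> borel_measurable borel"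
    by (intro borel_measurable_continuous_onI continuous_intros)
  have [measurable]: "U \<in> sets borel" using U by simp
  let ?g = "\<lambda>k y. real (Suc k) * min (1 / real (Suc k)) (infdist y (- U))"
  have bound: "\<bar>?g k y\<bar> \<le> 1" for k y
    using infdist_nonneg[of y "- U"] by (auto simp: abs_mult min_def field_simps)
  have lim: "(\<lambda>k. ?g k y) \<longlonglongrightarrow> indicator U y" for y
  proof (cases "y \<in> U")
    case True
    \<comment> \<open>As \<open>U\<close> is not the whole space, its complement is nonempty;
      \<open>infdist\<close> to the empty set would be 0 by convention.\<close>
    then have "0 < infdist y (- U)"
      using U by (intro infdist_pos_not_in_closed) auto
    then obtain N where N: "1 / infdist y (- U) \<le> real N"
      using real_arch_simple by blast
    have "?g k y = 1" if "N \<le> k" for k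
    proof -
      have "1 / infdist y (- U) \<le> real (Suc k)" using N that by linarith
      then have "1 / real (Suc k) \<le> infdist y (- U)"
        using \<open>0 < infdist y (- U)\<close> by (simp add: field_simps)
      then show ?thesis by simp
    qed
    then have "eventually (\<lambda>k. ?g k y = 1) sequentially"
      by (auto simp: eventually_sequentially)
    then show ?thesis using True by (simp add: tendsto_eventually)
  qed simp
  have "(\<lambda>k. \<integral>y. p y * ?g k y \<partial>lborel) \<longlonglongrightarrow> (\<integral>y. p y * indicator U y \<partial>lborel)"
  proof (rule integral_dominated_convergence[where w=p])
    show "AE y in lborel. (\<lambda>k. p y * ?g k y) \<longlonglongrightarrow> p y * indicator U y"
      by (intro AE_I2 tendsto_mult_left lim)
    show "AE y in lborel. norm (p y * ?g k y) \<le> p y" for k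
    proof (rule AE_I2)
      show "norm (p y * ?g k y) \<le> p y" for y
        using mult_left_mono[OF bound[of k y] nonneg[of y]] nonneg[of y]
        unfolding real_norm_def abs_mult[of "p y"] by simp
    qed
  qed (use int in measurable)
  also have "(\<lambda>k. \<integral>y. p y * ?g k y \<partial>lborel) =
      (\<lambda>k. real (Suc k) * (\<integral>y. p y * min (1 / real (Suc k)) (infdist y (- U)) \<partial>lborel))"
    by (simp only: mult.left_commute[of "p _"] integral_mult_right_zero)
  finally have "(\<lambda>k. ennreal (real (Suc k) * (\<integral>y. p y * min (1 / real (Suc k)) (infdist y (- U)) \<partial>lborel)))
      \<longlonglongrightarrow> ennreal (\<integral>y. p y * indicator U y \<partial>lborel)"
    by (rule tendsto_ennrealI)
  also have "ennreal (\<integral>y. p y * indicator U y \<partial>lborel) = (\<integral>\<^sup>+y. ennreal (p y * indicator U y) \<partial>lborel)"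
    using nonneg int by (intro nn_integral_eq_integral[symmetric] integrable_real_mult_indicator) auto
  also have "\<dots> = emeasure (law p) U"
    by (subst emeasure_density) (auto intro!: nn_integral_cong split: split_indicator)
  finally show ?thesis .
qed

text \<open>The test functions are truncated distances to complements of sets from a countable
  intersection-stable generator. Equal integrals give equal masses on the generator, hence equal
  laws and almost everywhere equal densities.\<close>

lemma countable_lipschitz_separating:
  obtains \<Phi> :: "(real^'d \<Rightarrow> real) set" where "countable \<Phi>"
    "\<And>\<phi> a b. \<phi> \<in> \<Phi> \<Longrightarrow> \<bar>\<phi> a - \<phi> b\<bar> \<le> norm (a - b)"
    "\<And>\<phi> a. \<phi> \<in> \<Phi> \<Longrightarrow> \<bar>\<phi> a\<bar> \<le> 1"
    "\<And>p q. prob_density p \<Longrightarrow> prob_density q \<Longrightarrow>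
      (\<And>\<phi>. \<phi> \<in> \<Phi> \<Longrightarrow> (\<integral>y. p y * \<phi> y \<partial>lborel) = (\<integral>y. q y * \<phi> y \<partial>lborel)) \<Longrightarrow>
      AE y in lborel. p y = q y"
proof -
  obtain B :: "(real^'d) set set" where B: "countable B" "topological_basis B"
    using ex_countable_basis by blast
  define C where "C = Inter ` {F. finite F \<and> F \<subseteq> B}"
  have C_count: "countable C"
    unfolding C_def by (intro countable_image countable_Collect_finite_subset B)
  have C_open: "open U" if "U \<in> C" for U
    using that topological_basis_open[OF B(2)] by (auto simp: C_def intro!: open_Inter)
  have C_int: "Int_stable C"
  proof (rule Int_stableI)
    fix U V assume "U \<in> C" "V \<in> C"
    then obtain F G where "finite F" "F \<subseteq> B" "U = \<Inter>F" "finite G" "G \<subseteq> B" "V = \<Inter>G"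
      by (auto simp: C_def)
    then show "U \<inter> V \<in> C"
      by (auto simp: C_def Inter_Un_distrib[symmetric] intro!: imageI)
  qed
  have "B \<subseteq> C"
  proof
    fix U assume "U \<in> B"
    then show "U \<in> C" unfolding C_def by (intro image_eqI[of _ _ "{U}"]) auto
  qed
  moreover have "UNIV \<in> C" unfolding C_def by (intro image_eqI[of _ _ "{}"]) auto
  moreover have "topological_basis C"
    using B(2) \<open>B \<subseteq> C\<close> C_open unfolding topological_basis_def by (meson subset_trans)
  then have C_sets: "sets borel = sigma_sets UNIV C"
    using borel_eq_countable_basis[OF C_count] sets_measure_of[of C UNIV "\<lambda>_. 0"]
    by (metis sets_measure_of_conv subset_UNIV Pow_UNIV)
  \<comment> \<open>Truncating at 1/(k+1) without rescaling keeps the Lipschitz constant and the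
    bound at 1; \<open>emeasure_law_eq_limit\<close> restores the factor k+1.\<close>
  define \<Phi> where "\<Phi> = (\<lambda>(U, k) y. min (1 / real (Suc k)) (infdist y (- U))) ` (C \<times> UNIV)"
  show ?thesis
  proof
    show "countable \<Phi>" unfolding \<Phi>_def using C_count by simp
    show "\<bar>\<phi> a - \<phi> b\<bar> \<le> norm (a - b)" if "\<phi> \<in> \<Phi>" for \<phi> a b
    proof -
      obtain U k where \<phi>: "\<phi> = (\<lambda>y. min (1 / real (Suc k)) (infdist y (- U)))"
        using \<open>\<phi> \<in> \<Phi>\<close> by (auto simp: \<Phi>_def simp del: of_nat_Suc)
      show ?thesis
        using infdist_triangle_abs[of a "- U" b] unfolding \<phi> dist_norm by linarith
    qed
    show "\<bar>\<phi> a\<bar> \<le> 1" if "\<phi> \<in> \<Phi>" for \<phi> a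
    proof -
      obtain U k where \<phi>: "\<phi> = (\<lambda>y. min (1 / real (Suc k)) (infdist y (- U)))"
        using \<open>\<phi> \<in> \<Phi>\<close> by (auto simp: \<Phi>_def simp del: of_nat_Suc)
      have "1 / real (Suc k) \<le> 1" "0 \<le> 1 / real (Suc k)" by simp_all
      then show ?thesis
        using infdist_nonneg[of a "- U"] unfolding \<phi> by linarith
    qed
    fix p q :: "real^'d \<Rightarrow> real"
    assume p: "prob_density p" and q: "prob_density q"
      and eq: "\<And>\<phi>. \<phi> \<in> \<Phi> \<Longrightarrow> (\<integral>y. p y * \<phi> y \<partial>lborel) = (\<integral>y. q y * \<phi> y \<partial>lborel)"
    have UNIV: "emeasure (law p) UNIV = 1" if "prob_density p" for p :: "real^'d \<Rightarrow> real"
      using that prob_density_measurable[OF that]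
      by (auto simp: emeasure_density prob_density_def has_bochner_integral_iff nn_integral_eq_integral)
    have "law p = law q"
    proof (rule measure_eqI_generator_eq_countable[OF C_int, where A="{UNIV}"])
      fix U assume U: "U \<in> C"
      show "emeasure (law p) U = emeasure (law q) U"
      \<comment> \<open>For the whole space the test functions vanish identically, so there both
        masses are computed as 1.\<close>
      proof (cases "U = UNIV")
        case False
        have "(\<integral>y. p y * min (1 / real (Suc k)) (infdist y (- U)) \<partial>lborel)
            = (\<integral>y. q y * min (1 / real (Suc k)) (infdist y (- U)) \<partial>lborel)" for k
          using U by (intro eq) (auto simp: \<Phi>_def)
        then show ?thesis
          using emeasure_law_eq_limit[OF p C_open[OF U] False] emeasure_law_eq_limit[OF q C_open[OF U] False]
          by (simp add: LIMSEQ_unique)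
      qed (simp add: UNIV[OF p] UNIV[OF q])
    qed (use \<open>UNIV \<in> C\<close> C_sets UNIV[OF p] in auto)
    then have "AE y in lborel. ennreal (p y) = ennreal (q y)"
      using prob_density_measurable[OF p] prob_density_measurable[OF q]
      by (intro sigma_finite_measure.density_unique[OF sigma_finite_lborel]) auto
    then show "AE y in lborel. p y = q y"
      using p q by (auto simp: prob_density_def)
  qed
qed

section \<open>Superadditivity of the lower integral and comparison of risks\<close>

text \<open>For a nonmeasurable \<open>f\<close> the integral is a lower integral, which is still superadditive.\<close>

lemma nn_integral_add_measurable_le:
  assumes [measurable]: "g \<in> borel_measurable M"
  shows "integral\<^sup>N M f + integral\<^sup>N M g \<le> (\<integral>\<^sup>+x. f x + g x \<partial>M)"
proof -
  \<comment> \<open>For any \<open>f\<close> the integral is a supremum over simple functions below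
    it. These are measurable, so additivity applies to each one before the supremum is
    taken.\<close>
  let ?U = "{u. simple_function M u \<and> u \<le> f}"
  have "(\<lambda>_. 0) \<in> ?U" by (simp add: le_fun_def)
  then have "integral\<^sup>N M f + integral\<^sup>N M g = (SUP u\<in>?U. integral\<^sup>S M u + integral\<^sup>N M g)"
    unfolding nn_integral_def[of M f] by (intro ennreal_SUP_add_left[symmetric]) blast
  also have "\<dots> \<le> (\<integral>\<^sup>+x. f x + g x \<partial>M)"
  proof (rule SUP_least)
    fix u assume u: "u \<in> ?U"
    then have [measurable]: "u \<in> borel_measurable M" by (auto dest: borel_measurable_simple_function)
    have "integral\<^sup>S M u + integral\<^sup>N M g = (\<integral>\<^sup>+x. u x + g x \<partial>M)"
      using u by (simp add: nn_integral_eq_simple_integral nn_integral_add)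
    also have "\<dots> \<le> (\<integral>\<^sup>+x. f x + g x \<partial>M)"
      using u by (intro nn_integral_mono add_right_mono) (auto simp: le_fun_def)
    finally show "integral\<^sup>S M u + integral\<^sup>N M g \<le> (\<integral>\<^sup>+x. f x + g x \<partial>M)" .
  qed
  finally show ?thesis .
qed

text \<open>A strict inequality is impossible at parameters where \<open>phat\<close> and its
  plug-in density describe the same distributions, since the risks then agree, or where the plug-in
  risk is infinite. Domination is therefore tied to a parameter where neither happens.\<close>

theorem proposition4p1:
  fixes f :: "real^'d \<Rightarrow> real"
    and phat :: "real^'d^'n \<Rightarrow> real^'d \<Rightarrow> real"
    and muhat :: "real^'d^'n \<Rightarrow> real^'d"
    and Sigmahat :: "real^'d^'n \<Rightarrow> real^'d^'d"
  assumes "standardized_density f"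
    and "predictive_density phat"
    and "\<And>xs. has_mean_covariance (phat xs) (muhat xs) (Sigmahat xs)"
  shows "(\<forall>\<mu> \<sigma>. 0 < \<sigma> \<longrightarrow> risk f \<mu> \<sigma> (plug_in f muhat Sigmahat) \<le> risk f \<mu> \<sigma> phat) \<and>
    ((\<exists>\<mu> \<sigma>. 0 < \<sigma> \<and> risk f \<mu> \<sigma> (plug_in f muhat Sigmahat) < \<infinity> \<and>
        \<not> same_predictive f \<mu> \<sigma> phat (plug_in f muhat Sigmahat)) \<longrightarrow>
      dominates f (plug_in f muhat Sigmahat) phat)"
proof -
  note f = assms(1) and S = assms(3)
  have q: "prob_density (phat xs)" for xs using assms(2) by (simp add: predictive_density_def)
  have fd: "prob_density f" using f by (simp add: standardized_density_def)
  define s where "s xs = trace (mat_sqrt (Sigmahat xs)) / real CARD('d)" for xs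
  have s: "0 < s xs" for xs
    using trace_mat_sqrt_pos[OF pos_semidef_covariance[OF q S] invertible_covariance[OF q S]]
    by (simp add: s_def)
  let ?plug = "plug_in f muhat Sigmahat"
  have plug: "?plug xs = loc_scale f (muhat xs) (s xs)" for xs
    by (simp add: plug_in_def s_def)
  \<comment> \<open>The part of the excess loss that the test function \<phi> detects, as bounded in
    \<open>W2_loss_ge\<close>.\<close>
  define \<delta> where "\<delta> \<sigma> \<phi> xs = min 1 (\<sigma> / s xs) *
      ((\<integral>y. ?plug xs y * \<phi> y \<partial>lborel) - (\<integral>y. phat xs y * \<phi> y \<partial>lborel))\<^sup>2" for \<sigma> \<phi> xs
  have loss: "W2_loss (loc_scale f \<mu> \<sigma>) (?plug xs) + ennreal (\<delta> \<sigma> \<phi> xs) \<le> W2_loss (loc_scale f \<mu> \<sigma>) (phat xs)"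
    if \<sigma>: "0 < \<sigma>" and \<phi>: "\<And>a b. \<bar>\<phi> a - \<phi> b\<bar> \<le> norm (a - b)" "\<And>a. \<bar>\<phi> a\<bar> \<le> 1" for \<mu> \<sigma> \<phi> xs
  proof -
    have "W2_loss (loc_scale f \<mu> \<sigma>) (?plug xs) + ennreal (\<delta> \<sigma> \<phi> xs)
        \<le> ennreal ((norm (\<mu> - muhat xs))\<^sup>2 + real CARD('d) * (\<sigma> - s xs)\<^sup>2) + ennreal (\<delta> \<sigma> \<phi> xs)"
      unfolding plug by (intro add_right_mono W2_loss_loc_scale_le f \<sigma> s)
    also have "\<dots> \<le> W2_loss (loc_scale f \<mu> \<sigma>) (phat xs)"
      using W2_loss_ge[OF f \<sigma> q S \<phi>] by (simp add: \<delta>_def plug s_def)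
    finally show ?thesis .
  qed
  \<comment> \<open>The zero test function makes \<delta> vanish and leaves the plain comparison of
    losses.\<close>
  have le: "risk f \<mu> \<sigma> ?plug \<le> risk f \<mu> \<sigma> phat" if \<sigma>: "0 < \<sigma>" for \<mu> \<sigma>
    unfolding risk_def using loss[OF \<sigma>, of "\<lambda>_. 0"]
    by (intro nn_integral_mono mult_right_mono) (auto simp: \<delta>_def)
  have less: "risk f \<mu> \<sigma> ?plug < risk f \<mu> \<sigma> phat"
    if \<sigma>: "0 < \<sigma>" and fin: "risk f \<mu> \<sigma> ?plug < \<infinity>" and diff: "\<not> same_predictive f \<mu> \<sigma> phat ?plug" for \<mu> \<sigma>
  proof -
    let ?\<rho> = "sample_density f \<mu> \<sigma> :: real^'d^'n \<Rightarrow> real"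
    obtain \<Phi> :: "(real^'d \<Rightarrow> real) set" where \<Phi>: "countable \<Phi>"
      "\<And>\<phi> a b. \<phi> \<in> \<Phi> \<Longrightarrow> \<bar>\<phi> a - \<phi> b\<bar> \<le> norm (a - b)" "\<And>\<phi> a. \<phi> \<in> \<Phi> \<Longrightarrow> \<bar>\<phi> a\<bar> \<le> 1"
      "\<And>p q. prob_density p \<Longrightarrow> prob_density q \<Longrightarrow>
        (\<And>\<phi>. \<phi> \<in> \<Phi> \<Longrightarrow> (\<integral>y. p y * \<phi> y \<partial>lborel) = (\<integral>y. q y * \<phi> y \<partial>lborel)) \<Longrightarrow>
        AE y in lborel. p y = q y"
      by (rule countable_lipschitz_separating) blast
    \<comment> \<open>Countability of \<Phi> allows the quantifier over test functions to move
      inside the almost-everywhere statement, so a single \<phi> witnesses the difference on a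
      non-null set of samples.\<close>
    have "\<exists>\<phi>\<in>\<Phi>. \<not> (AE xs in density lborel (\<lambda>xs. ennreal (?\<rho> xs)).
        (\<integral>y. phat xs y * \<phi> y \<partial>lborel) = (\<integral>y. ?plug xs y * \<phi> y \<partial>lborel))"
    proof (rule ccontr)
      assume "\<not> ?thesis"
      then have "AE xs in density lborel (\<lambda>xs. ennreal (?\<rho> xs)). \<forall>\<phi>\<in>\<Phi>.
          (\<integral>y. phat xs y * \<phi> y \<partial>lborel) = (\<integral>y. ?plug xs y * \<phi> y \<partial>lborel)"
        by (simp add: AE_ball_countable[OF \<Phi>(1)])
      then have "AE xs in density lborel (\<lambda>xs. ennreal (?\<rho> xs)). AE y in lborel. phat xs y = ?plug xs y"
      proof (rule eventually_mono)
        show "AE y in lborel. phat xs y = ?plug xs y"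
          if "\<forall>\<phi>\<in>\<Phi>. (\<integral>y. phat xs y * \<phi> y \<partial>lborel) = (\<integral>y. ?plug xs y * \<phi> y \<partial>lborel)" for xs
          using that by (intro \<Phi>(4) q) (simp_all add: plug prob_density_loc_scale[OF fd s])
      qed
      then have "same_predictive f \<mu> \<sigma> phat ?plug"
        by (simp add: same_predictive_def)
      with diff show False by simp
    qed
    then obtain \<phi> where \<phi>: "\<phi> \<in> \<Phi>" and ne: "\<not> (AE xs in density lborel (\<lambda>xs. ennreal (?\<rho> xs)).
        (\<integral>y. phat xs y * \<phi> y \<partial>lborel) = (\<integral>y. ?plug xs y * \<phi> y \<partial>lborel))" by blast
    have "continuous_on UNIV \<phi>"
      unfolding continuous_on_iff dist_norm real_norm_def using \<Phi>(2)[OF \<phi>] le_less_trans by blast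
    then have [measurable]: "\<phi> \<in> borel_measurable borel"
      by (rule borel_measurable_continuous_onI)
    note [measurable] = prob_density_measurable[OF fd]
    have [measurable]: "(\<lambda>(xs, y). phat xs y) \<in> borel_measurable (borel \<Otimes>\<^sub>M borel)"
      using assms(2) by (simp add: predictive_density_def borel_prod)
    \<comment> \<open>Mean and covariance are parameter integrals of the jointly measurable
      \<open>phat\<close>, which makes both estimators measurable in the sample.\<close>
    have "muhat = (\<lambda>xs. \<integral>y. phat xs y *\<^sub>R y \<partial>lborel)"
      using S by (auto simp: has_mean_covariance_def has_mean_def has_bochner_integral_iff)
    then have [measurable]: "muhat \<in> borel_measurable borel" by simp
    have "Sigmahat = (\<lambda>xs. \<integral>y. phat xs y *\<^sub>R outer_product (y - muhat xs) (y - muhat xs) \<partial>lborel)"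
      using S by (auto simp: has_mean_covariance_def has_bochner_integral_iff)
    then have [measurable]: "Sigmahat \<in> borel_measurable borel" by simp
    \<comment> \<open>\<open>mat_sqrt\<close> is known to be measurable on the positive semidefinite
      matrices, where all values of \<open>Sigmahat\<close> lie.\<close>
    have "(\<lambda>xs. mat_sqrt (Sigmahat xs)) \<in> borel_measurable borel"
      by (rule measurable_compose[OF measurable_restrict_space2 borel_measurable_mat_sqrt])
        (auto intro: pos_semidef_covariance[OF q S])
    moreover have "continuous_on UNIV (trace :: real^'d^'d \<Rightarrow> real)"
      unfolding trace_def by (intro continuous_intros)
    ultimately have [measurable]: "s \<in> borel_measurable borel"
      unfolding s_def by (intro borel_measurable_divide borel_measurable_const)
        (rule measurable_compose[OF _ borel_measurable_continuous_onI])
    have [measurable]: "(\<lambda>(xs, y). ?plug xs y) \<in> borel_measurable (borel \<Otimes>\<^sub>M borel)"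
      unfolding plug loc_scale_def by measurable
    have [measurable]: "?\<rho> \<in> borel_measurable borel"
    proof -
      have [measurable]: "(\<lambda>xs. xs $ i) \<in> borel_measurable borel" for i :: 'n
        by (intro borel_measurable_continuous_onI continuous_intros)
      show ?thesis unfolding sample_density_def loc_scale_def by measurable
    qed
    have [measurable]: "\<delta> \<sigma> \<phi> \<in> borel_measurable borel"
      unfolding \<delta>_def by measurable
    \<comment> \<open>The factor min(1, \<sigma>/s) is positive, so a vanishing integral would make
      the two test integrals agree for almost every sample, against the choice of \<phi>.\<close>
    have "(\<integral>\<^sup>+xs. ennreal (\<delta> \<sigma> \<phi> xs) * ennreal (?\<rho> xs) \<partial>lborel) \<noteq> 0"
    proof
      assume "(\<integral>\<^sup>+xs. ennreal (\<delta> \<sigma> \<phi> xs) * ennreal (?\<rho> xs) \<partial>lborel) = 0"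
      then have "AE xs in lborel. ennreal (\<delta> \<sigma> \<phi> xs) * ennreal (?\<rho> xs) = 0"
        by (subst (asm) nn_integral_0_iff_AE) auto
      moreover have "(\<integral>y. phat xs y * \<phi> y \<partial>lborel) = (\<integral>y. ?plug xs y * \<phi> y \<partial>lborel)"
        if "ennreal (\<delta> \<sigma> \<phi> xs) * ennreal (?\<rho> xs) = 0" "0 < ennreal (?\<rho> xs)" for xs
      proof -
        have "\<delta> \<sigma> \<phi> xs \<le> 0" using that by (auto simp: ennreal_eq_0_iff)
        moreover have "0 < min 1 (\<sigma> / s xs)" using \<sigma> s[of xs] by simp
        ultimately show ?thesis by (auto simp: \<delta>_def mult_le_0_iff)
      qed
      ultimately have "AE xs in lborel. 0 < ennreal (?\<rho> xs) \<longrightarrow>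
          (\<integral>y. phat xs y * \<phi> y \<partial>lborel) = (\<integral>y. ?plug xs y * \<phi> y \<partial>lborel)"
        by (auto elim: eventually_mono)
      with ne show False by (subst (asm) AE_density) auto
    qed
    \<comment> \<open>Finiteness of the plug-in risk makes the added positive amount a strict
      increase. The sum is then merged by superadditivity, which asks for measurability of the
      \<delta> term alone.\<close>
    then have "risk f \<mu> \<sigma> ?plug < risk f \<mu> \<sigma> ?plug + (\<integral>\<^sup>+xs. ennreal (\<delta> \<sigma> \<phi> xs) * ennreal (?\<rho> xs) \<partial>lborel)"
      using fin by (simp add: ennreal_add_left_cancel_less zero_less_iff_neq_zero)
    also have "\<dots> \<le> (\<integral>\<^sup>+xs. W2_loss (loc_scale f \<mu> \<sigma>) (?plug xs) * ennreal (?\<rho> xs)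
        + ennreal (\<delta> \<sigma> \<phi> xs) * ennreal (?\<rho> xs) \<partial>lborel)"
      unfolding risk_def by (rule nn_integral_add_measurable_le) measurable
    also have "\<dots> \<le> risk f \<mu> \<sigma> phat"
      unfolding risk_def distrib_right[symmetric]
      by (intro nn_integral_mono mult_right_mono loss[OF \<sigma>] \<Phi>(2,3) \<phi>) simp
    finally show ?thesis .
  qed
  show ?thesis using le less unfolding dominates_def by blast
qed

end
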